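(* For any $n\ge 1$, any full ordered binary tree with leaves $1,\dots,n$ and any leaf coefficient states $(G_i,h_i,B_i)$, $i=1,\dots,n$, iterating the corrected merge along the tree returns the root state \[ \left(\sum_iG_i,\ \frac{\sum_iG_ih_i}{\sum_iG_i},\ \frac{\sum_iG_iB_i}{\sum_iG_i}\right). \] The corrected second-order coefficient state is independent of the aggregation tree.
   Context: Let $(\Omega,\mathcal F,\mu)$ be a measure space. A carried coefficient state is a triple $(G,H,B)$ where $G>0$ is a real number (transformed weight) and $H$, $B$ are zero-mass density coefficients, i.e. $\mu$-integrable real functions with $\int H\,d\mu=\int B\,d\mu=0$ (first- and second-order coefficients). The corrected merge of states $(G_A,H_A,B_A)$ and $(G_B,H_B,B_B)$ is the state \[ \left(G_A+G_B,\ \frac{G_AH_A+G_BH_B}{G_A+G_B},\ \frac{G_AB_A+G_BB_B}{G_A+G_B}\right). \] For an ordered binary tree, the state $(G_i,h_i,B_i)$ is placed at leaf $i$ and the corrected merge is applied at every internal node to the states of its left and right children; the root state is the state obtained at the root. *)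

theory Defs
  imports "HOL-Analysis.Analysis"
begin

text \<open>Raw triples \<open>(G, H, B)\<close>: transformed weight, first-order coefficient, second-order
  coefficient. The constraints relative to a measure are in \<open>carried_state\<close>. Coefficients are
  genuine functions, not classes modulo null sets.\<close>

type_synonym 'a coeff_state = "real \<times> ('a \<Rightarrow> real) \<times> ('a \<Rightarrow> real)"

definition zero_mass :: "'a measure \<Rightarrow> ('a \<Rightarrow> real) \<Rightarrow> bool" where
  "zero_mass M H \<longleftrightarrow> integrable M H \<and> integral\<^sup>L M H = 0"

fun carried_state :: "'a measure \<Rightarrow> 'a coeff_state \<Rightarrow> bool" where
  "carried_state M (G, H, B) \<longleftrightarrow> G > 0 \<and> zero_mass M H \<and> zero_mass M B"

fun corrected_merge :: "'a coeff_state \<Rightarrow> 'a coeff_state \<Rightarrow> 'a coeff_state" where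
  "corrected_merge (G\<^sub>A, H\<^sub>A, B\<^sub>A) (G\<^sub>B, H\<^sub>B, B\<^sub>B) =
     (G\<^sub>A + G\<^sub>B,
      \<lambda>x. (G\<^sub>A * H\<^sub>A x + G\<^sub>B * H\<^sub>B x) / (G\<^sub>A + G\<^sub>B),
      \<lambda>x. (G\<^sub>A * B\<^sub>A x + G\<^sub>B * B\<^sub>B x) / (G\<^sub>A + G\<^sub>B))"

datatype agg_tree = Leaf nat | Node agg_tree agg_tree

fun leaves :: "agg_tree \<Rightarrow> nat list" where
  "leaves (Leaf i) = [i]"
| "leaves (Node l r) = leaves l @ leaves r"

text \<open>Each of the labels \<open>1, \<dots>, n\<close> occurs at exactly one leaf; the labels may
  occur in any left-to-right order.\<close>

definition tree_on :: "nat \<Rightarrow> agg_tree \<Rightarrow> bool" where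
  "tree_on n t \<longleftrightarrow> distinct (leaves t) \<and> set (leaves t) = {1..n}"

fun root_state :: "(nat \<Rightarrow> 'a coeff_state) \<Rightarrow> agg_tree \<Rightarrow> 'a coeff_state" where
  "root_state s (Leaf i) = s i"
| "root_state s (Node l r) = corrected_merge (root_state s l) (root_state s r)"

end

theory Submission
  imports Defs
begin

text \<open>Weight times coefficient is additive under the corrected merge. At every node the weight is
  therefore the sum of the leaf weights below it, and weight times coefficient the sum of the leaf
  products, so the state depends only on the set of leaves below the node.\<close>

lemma leaves_nonempty: "leaves t \<noteq> []"
  by (induction t) auto

text \<open>Zero-mass functions form a linear space, and the merged coefficients are linear
  combinations of the given ones.\<close>

lemma corrected_merge_carried_state:
  assumes "carried_state M S" and "carried_state M T"
  shows "carried_state M (corrected_merge S T)"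
  using assms by (cases S; cases T) (auto simp: zero_mass_def)

lemma root_state_carried_state:
  assumes "\<And>i. i \<in> set (leaves t) \<Longrightarrow> carried_state M (s i)"
  shows "carried_state M (root_state s t)"
  using assms by (induction t) (auto intro: corrected_merge_carried_state)

text \<open>Distinctness matters because the sums range over a set: a repeated label would be merged
  twice but summed once.\<close>

lemma root_state_eq_weighted_mean:
  fixes G :: "nat \<Rightarrow> real" and h B :: "nat \<Rightarrow> 'a \<Rightarrow> real"
  assumes "distinct (leaves t)" and "\<And>i. i \<in> set (leaves t) \<Longrightarrow> G i > 0"
  shows "root_state (\<lambda>i. (G i, h i, B i)) t =
           (\<Sum>i\<in>set (leaves t). G i,
            \<lambda>x. (\<Sum>i\<in>set (leaves t). G i * h i x) / (\<Sum>i\<in>set (leaves t). G i),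
            \<lambda>x. (\<Sum>i\<in>set (leaves t). G i * B i x) / (\<Sum>i\<in>set (leaves t). G i))"
  using assms
proof (induction t)
  case (Leaf i)
  then have "G i \<noteq> 0" by force
  then show ?case by simp
next
  case (Node l r)
  \<comment> \<open>Strict positivity of a sum of positive terms needs a nonempty index set, hence
    \<open>leaves_nonempty\<close>.\<close>
  have pos: "(\<Sum>i\<in>set (leaves u). G i) > 0" if "u \<in> {l, r}" for u
    using that Node.prems(2) by (intro sum_pos) (auto simp: leaves_nonempty)
  \<comment> \<open>The merge multiplies each child's mean by the child's weight; a nonzero weight
    cancels the denominator and leaves the sum of products.\<close>
  have "(\<Sum>i\<in>set (leaves l). G i) \<noteq> 0" "(\<Sum>i\<in>set (leaves r). G i) \<noteq> 0"
    using pos[of l] pos[of r] by auto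
  moreover have "set (leaves l) \<inter> set (leaves r) = {}"
    using Node.prems(1) by simp
  ultimately show ?case
    using Node by (simp add: sum.union_disjoint)
qed

theorem theorem10:
  fixes M :: "'a measure" and n :: nat and t :: agg_tree
    and G :: "nat \<Rightarrow> real" and h B :: "nat \<Rightarrow> 'a \<Rightarrow> real"
  assumes "n \<ge> 1"
    and "tree_on n t"
    and "\<And>i. i \<in> {1..n} \<Longrightarrow> carried_state M (G i, h i, B i)"
  shows "root_state (\<lambda>i. (G i, h i, B i)) t =
           (\<Sum>i=1..n. G i,
            \<lambda>x. (\<Sum>i=1..n. G i * h i x) / (\<Sum>i=1..n. G i),
            \<lambda>x. (\<Sum>i=1..n. G i * B i x) / (\<Sum>i=1..n. G i))
       \<and> carried_state M (root_state (\<lambda>i. (G i, h i, B i)) t)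
       \<and> (\<forall>t'. tree_on n t' \<longrightarrow>
            root_state (\<lambda>i. (G i, h i, B i)) t' = root_state (\<lambda>i. (G i, h i, B i)) t)"
proof -
  have pos: "G i > 0" if "i \<in> {1..n}" for i
    using assms(3)[OF that] by simp
  \<comment> \<open>The right-hand side does not mention \<open>u\<close>, so this one fact yields
    both the formula for \<open>t\<close> and the independence of the tree.\<close>
  have mean: "root_state (\<lambda>i. (G i, h i, B i)) u =
           (\<Sum>i=1..n. G i,
            \<lambda>x. (\<Sum>i=1..n. G i * h i x) / (\<Sum>i=1..n. G i),
            \<lambda>x. (\<Sum>i=1..n. G i * B i x) / (\<Sum>i=1..n. G i))" if "tree_on n u" for u
    using that pos root_state_eq_weighted_mean[of u G h B] by (simp add: tree_on_def)
  have "carried_state M (root_state (\<lambda>i. (G i, h i, B i)) t)"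
    using assms(2,3) by (intro root_state_carried_state) (simp add: tree_on_def)
  then show ?thesis
    \<comment> \<open>\<open>mean\<close> rewrites the root state to an explicit triple; keeping
      \<open>carried_state\<close> folded lets the chained fact match the goal directly.\<close>
    by (simp add: mean assms(2) del: carried_state.simps)
qed

end
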